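(* Let $K$ be an algebraically closed field of characteristic zero and let $n \geq 1$. The subalgebra $s_n(K) = (P_0 + x_1P_0)\partial_1 + (P_1 + x_2P_1)\partial_2 + \cdots + (P_{n-1} + x_nP_{n-1})\partial_n$ is a maximal solvable subalgebra of the Lie algebra $W_n(K)$; that is, $s_n(K)$ is a solvable subalgebra of $W_n(K)$ and there is no solvable Lie subalgebra $S$ of $W_n(K)$ that properly contains $s_n(K)$.
   Context: For $1 \leq i \leq n$, $P_i = K[x_1,\ldots,x_i]$ is the polynomial ring, and $P_0 = K$; all $P_i$ are regarded as subrings of $P_n = K[x_1,\ldots,x_n]$. $W_n(K)$ is the Lie algebra over $K$ of all $K$-derivations of $P_n$, with bracket $[D_1,D_2] = D_1D_2 - D_2D_1$. Its elements are uniquely of the form $f_1\partial_1 + \cdots + f_n\partial_n$ with $f_i \in P_n$, where $\partial_i = \partial/\partial x_i$. Thus $s_n(K)$ consists of all $f_1\partial_1+\cdots+f_n\partial_n$ with $f_i = a_i + x_i b_i$, $a_i, b_i \in P_{i-1}$, for $i=1,\ldots,n$. *)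

theory Defs
  imports
    "HOL-Computational_Algebra.Polynomial"
    "HOL-Library.Poly_Mapping"
    "HOL-Library.Function_Algebras"
begin

section \<open>Polynomials\<close>

text \<open>
  A monomial is a finitely supported exponent vector of type \<^typ>\<open>nat \<Rightarrow>\<^sub>0 nat\<close>, and multiplication
  on \<^typ>\<open>(nat \<Rightarrow>\<^sub>0 nat) \<Rightarrow>\<^sub>0 'a\<close> is the convolution product.  The type contains the polynomials in
  infinitely many variables indexed by \<^typ>\<open>nat\<close>; \<open>polys i\<close> cuts out the ring in
  \<open>x\<^sub>1, \<dots>, x\<^sub>i\<close>, so that \<open>polys 0\<close> consists of the constants.
\<close>

type_synonym 'a mpoly = "(nat \<Rightarrow>\<^sub>0 nat) \<Rightarrow>\<^sub>0 'a"

definition polys :: "nat \<Rightarrow> 'a::field mpoly set" where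
  "polys i = {p. \<forall>m \<in> Poly_Mapping.keys p. Poly_Mapping.keys m \<subseteq> {1..i}}"

definition mconst :: "'a::field \<Rightarrow> 'a mpoly" where
  "mconst c = Poly_Mapping.single 0 c"

definition mvar :: "nat \<Rightarrow> 'a::field mpoly" where
  "mvar i = Poly_Mapping.single (Poly_Mapping.single i 1) 1"

text \<open>
  The difference of exponent vectors is truncated, but when \<open>m\<close> does not involve
  \<open>x\<^sub>i\<close> the coefficient vanishes.
\<close>
definition partial :: "nat \<Rightarrow> 'a::field mpoly \<Rightarrow> 'a mpoly" where
  "partial i p =
     (\<Sum>m \<in> Poly_Mapping.keys p.
        Poly_Mapping.single (m - Poly_Mapping.single i 1)
          (of_nat (Poly_Mapping.lookup m i) * Poly_Mapping.lookup p m))"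

section \<open>The Lie algebra of derivations\<close>

text \<open>
  Addition and zero of operators are pointwise.
\<close>
definition op_scale :: "'a::field \<Rightarrow> ('a mpoly \<Rightarrow> 'a mpoly) \<Rightarrow> ('a mpoly \<Rightarrow> 'a mpoly)" where
  "op_scale c D = (\<lambda>p. mconst c * D p)"

interpretation opr: vector_space op_scale
proof
qed (auto simp: op_scale_def mconst_def fun_eq_iff algebra_simps single_add mult_single
       simp flip: single_one mult.assoc)

definition bracket ::
  "('a::field mpoly \<Rightarrow> 'a mpoly) \<Rightarrow> ('a mpoly \<Rightarrow> 'a mpoly) \<Rightarrow> ('a mpoly \<Rightarrow> 'a mpoly)" where
  "bracket D E = (D \<circ> E) - (E \<circ> D)"

text \<open>
  A map \<open>polys n \<rightarrow> polys n\<close> is represented by the function that is \<open>0\<close> outside \<open>polys n\<close>; this makes the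
  representation unique, so that equality in \<open>W_alg n\<close> is equality of maps on \<open>polys n\<close>.
\<close>
definition W_alg :: "nat \<Rightarrow> ('a::field mpoly \<Rightarrow> 'a mpoly) set" where
  "W_alg n = {D. (\<forall>p \<in> polys n. D p \<in> polys n) \<and>
             (\<forall>p \<in> polys n. \<forall>q \<in> polys n. D (p + q) = D p + D q) \<and>
             (\<forall>c. \<forall>p \<in> polys n. D (mconst c * p) = mconst c * D p) \<and>
             (\<forall>p \<in> polys n. \<forall>q \<in> polys n. D (p * q) = D p * q + p * D q) \<and>
             (\<forall>p. p \<notin> polys n \<longrightarrow> D p = 0)}"

definition vector_field :: "nat \<Rightarrow> (nat \<Rightarrow> 'a::field mpoly) \<Rightarrow> ('a mpoly \<Rightarrow> 'a mpoly)" where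
  "vector_field n f = (\<lambda>p. if p \<in> polys n then (\<Sum>i = 1..n. f i * partial i p) else 0)"

definition lie_subalgebra :: "nat \<Rightarrow> ('a::field mpoly \<Rightarrow> 'a mpoly) set \<Rightarrow> bool" where
  "lie_subalgebra n L \<longleftrightarrow>
     L \<subseteq> W_alg n \<and> opr.subspace L \<and> (\<forall>D \<in> L. \<forall>E \<in> L. bracket D E \<in> L)"

primrec derived_series ::
  "('a::field mpoly \<Rightarrow> 'a mpoly) set \<Rightarrow> nat \<Rightarrow> ('a mpoly \<Rightarrow> 'a mpoly) set" where
  "derived_series L 0 = L"
| "derived_series L (Suc k) =
     opr.span {bracket D E | D E. D \<in> derived_series L k \<and> E \<in> derived_series L k}"

definition lie_solvable :: "('a::field mpoly \<Rightarrow> 'a mpoly) set \<Rightarrow> bool" where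
  "lie_solvable L \<longleftrightarrow> (\<exists>k. derived_series L k = {0})"

definition s_alg :: "nat \<Rightarrow> ('a::field mpoly \<Rightarrow> 'a mpoly) set" where
  "s_alg n = {vector_field n f | f.
            \<forall>i \<in> {1..n}. \<exists>a \<in> polys (i - 1). \<exists>b \<in> polys (i - 1). f i = a + mvar i * b}"

section \<open>Basic facts\<close>

lemma mconst_in_polys [simp]: "mconst c \<in> polys n"
  by (auto simp: polys_def mconst_def)

lemma mvar_in_polys: "1 \<le> i \<Longrightarrow> i \<le> n \<Longrightarrow> mvar i \<in> polys n"
  by (auto simp: polys_def mvar_def)

lemma zero_in_polys [simp]: "0 \<in> polys n"
  by (simp add: polys_def)

lemma polys_mono: "i \<le> j \<Longrightarrow> polys i \<subseteq> polys j"
  by (fastforce simp: polys_def)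

lemma polys_0: "polys 0 = range mconst"
proof (intro equalityI subsetI)
  fix p :: "'a mpoly" assume "p \<in> polys 0"
  then have "Poly_Mapping.keys p \<subseteq> {0}" by (auto simp: polys_def)
  then have "p = mconst (Poly_Mapping.lookup p 0)"
    by (intro poly_mapping_eqI)
      (metis mconst_def in_keys_iff lookup_single_eq lookup_single_not_eq singletonD subsetD)
  then show "p \<in> range mconst" by blast
qed auto

lemma polys_add [intro]: "p \<in> polys n \<Longrightarrow> q \<in> polys n \<Longrightarrow> p + q \<in> polys n"
  using Poly_Mapping.keys_add[of p q] by (auto simp: polys_def)

lemma polys_diff [intro]: "p \<in> polys n \<Longrightarrow> q \<in> polys n \<Longrightarrow> p - q \<in> polys n"
  using keys_diff[of p q] by (auto simp: polys_def)

lemma polys_mult [intro]: "p \<in> polys n \<Longrightarrow> q \<in> polys n \<Longrightarrow> p * q \<in> polys n"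
  unfolding polys_def mem_Collect_eq
proof
  fix m assume p: "\<forall>m \<in> Poly_Mapping.keys p. Poly_Mapping.keys m \<subseteq> {1..n}"
    and q: "\<forall>m \<in> Poly_Mapping.keys q. Poly_Mapping.keys m \<subseteq> {1..n}"
    and "m \<in> Poly_Mapping.keys (p * q)"
  then obtain a b where "m = a + b" "a \<in> Poly_Mapping.keys p" "b \<in> Poly_Mapping.keys q"
    using keys_mult[of p q] by blast
  then show "Poly_Mapping.keys m \<subseteq> {1..n}"
    using p q Poly_Mapping.keys_add[of a b] by blast
qed

lemma polys_sum: "(\<And>i. i \<in> I \<Longrightarrow> f i \<in> polys n) \<Longrightarrow> sum f I \<in> polys n"
  by (induction I rule: infinite_finite_induct) auto

lemma partial_superset:
  assumes "finite A" "Poly_Mapping.keys p \<subseteq> A"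
  shows "partial i p =
     (\<Sum>m \<in> A. Poly_Mapping.single (m - Poly_Mapping.single i 1)
        (of_nat (Poly_Mapping.lookup m i) * Poly_Mapping.lookup p m))"
  unfolding partial_def
  using assms by (intro sum.mono_neutral_left) (auto simp: in_keys_iff)

lemma partial_add: "partial i (p + q) = partial i p + partial i q"
proof -
  let ?A = "Poly_Mapping.keys p \<union> Poly_Mapping.keys q"
  have "partial i r =
     (\<Sum>m \<in> ?A. Poly_Mapping.single (m - Poly_Mapping.single i 1)
        (of_nat (Poly_Mapping.lookup m i) * Poly_Mapping.lookup r m))"
    if "r \<in> {p, q, p + q}" for r
    using that Poly_Mapping.keys_add[of p q] by (intro partial_superset) auto
  then show ?thesis
    by (simp add: lookup_add distrib_left single_add sum.distrib)
qed

lemma partial_0 [simp]: "partial i 0 = 0"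
  by (simp add: partial_def)

lemma partial_sum: "partial i (sum f I) = (\<Sum>j \<in> I. partial i (f j))"
  by (induction I rule: infinite_finite_induct) (auto simp: partial_add)

lemma partial_single:
  "partial i (Poly_Mapping.single m c) =
     Poly_Mapping.single (m - Poly_Mapping.single i 1) (of_nat (Poly_Mapping.lookup m i) * c)"
  by (subst partial_superset[of "{m}"]) auto

lemma partial_const [simp]: "partial i (mconst c) = 0"
  by (simp add: mconst_def partial_single)

lemma partial_var: "partial i (mvar j) = (if i = j then 1 else 0)"
  by (auto simp: mvar_def partial_single lookup_single)

lemma mpoly_as_sum:
  "p = (\<Sum>m \<in> Poly_Mapping.keys p. Poly_Mapping.single m (Poly_Mapping.lookup p m))"
  by (rule poly_mapping_eqI) (auto simp: lookup_sum lookup_single when_def in_keys_iff)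

lemma partial_mult_single:
  "partial i (Poly_Mapping.single m c * Poly_Mapping.single k d) =
     partial i (Poly_Mapping.single m c) * Poly_Mapping.single k d +
     Poly_Mapping.single m c * partial i (Poly_Mapping.single k d)"
proof -
  let ?e = "Poly_Mapping.single i (1::nat)"
  have m: "m + k - ?e = m - ?e + k" if "Poly_Mapping.lookup m i \<noteq> 0"
    using that by (intro poly_mapping_eqI) (auto simp: lookup_add lookup_minus lookup_single when_def)
  have k: "m + k - ?e = m + (k - ?e)" if "Poly_Mapping.lookup k i \<noteq> 0"
    using that by (intro poly_mapping_eqI) (auto simp: lookup_add lookup_minus lookup_single when_def)
  show ?thesis
    using m k
    by (cases "Poly_Mapping.lookup m i = 0"; cases "Poly_Mapping.lookup k i = 0")
       (auto simp: partial_single mult_single lookup_add algebra_simps single_add)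
qed

lemma partial_mult: "partial i (p * q) = partial i p * q + p * partial i q"
proof -
  let ?s = "\<lambda>p m. Poly_Mapping.single m (Poly_Mapping.lookup p m)"
  let ?p = "\<Sum>m \<in> Poly_Mapping.keys p. ?s p m" and ?q = "\<Sum>m \<in> Poly_Mapping.keys q. ?s q m"
  have "partial i (?p * ?q) = partial i ?p * ?q + ?p * partial i ?q"
    by (simp only: sum_product partial_sum partial_mult_single sum.distrib)
  then show ?thesis
    unfolding mpoly_as_sum[symmetric] .
qed

lemma partial_in_polys:
  assumes "p \<in> polys n"
  shows "partial i p \<in> polys n"
  unfolding partial_def
proof (rule polys_sum)
  fix m assume "m \<in> Poly_Mapping.keys p"
  then have m: "Poly_Mapping.keys m \<subseteq> {1..n}"
    using assms unfolding polys_def by blast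
  have "Poly_Mapping.keys (m - Poly_Mapping.single i 1) \<subseteq> Poly_Mapping.keys m"
    by (auto simp: in_keys_iff lookup_minus)
  then have "Poly_Mapping.keys (m - Poly_Mapping.single i 1) \<subseteq> {1..n}"
    using m by (rule subset_trans)
  then show "Poly_Mapping.single (m - Poly_Mapping.single i 1)
      (of_nat (Poly_Mapping.lookup m i) * Poly_Mapping.lookup p m) \<in> polys n"
    by (simp add: polys_def)
qed

lemma vector_field_in_W_alg:
  assumes "\<And>i. i \<in> {1..n} \<Longrightarrow> f i \<in> polys n"
  shows "vector_field n f \<in> W_alg n"
proof -
  have *: "vector_field n f p \<in> polys n" for p
    unfolding vector_field_def using assms by (auto intro!: polys_sum polys_mult partial_in_polys)
  show ?thesis
    unfolding W_alg_def
  proof (intro CollectI conjI ballI allI impI)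
    fix p q :: "'a mpoly" assume pq: "p \<in> polys n" "q \<in> polys n"
    show "vector_field n f (p + q) = vector_field n f p + vector_field n f q"
      using pq by (simp add: vector_field_def polys_add partial_add distrib_left sum.distrib)
    show "vector_field n f (p * q) = vector_field n f p * q + p * vector_field n f q"
      using pq by (simp add: vector_field_def polys_mult partial_mult distrib_left sum.distrib
          sum_distrib_left sum_distrib_right mult_ac)
  next
    fix c :: 'a and p :: "'a mpoly" assume "p \<in> polys n"
    then show "vector_field n f (mconst c * p) = mconst c * vector_field n f p"
      by (simp add: vector_field_def polys_mult partial_mult sum_distrib_left mult_ac)
  qed (rule *, simp add: vector_field_def)
qed

lemma bracket_apply: "bracket D E p = D (E p) - E (D p)"
  by (simp add: bracket_def)

lemma W_alg_D:
  assumes "D \<in> W_alg n"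
  shows "p \<in> polys n \<Longrightarrow> D p \<in> polys n"
    and "p \<in> polys n \<Longrightarrow> q \<in> polys n \<Longrightarrow> D (p + q) = D p + D q"
    and "p \<in> polys n \<Longrightarrow> D (mconst c * p) = mconst c * D p"
    and "p \<in> polys n \<Longrightarrow> q \<in> polys n \<Longrightarrow> D (p * q) = D p * q + p * D q"
    and "p \<notin> polys n \<Longrightarrow> D p = 0"
    and "D 0 = 0"
proof -
  note D = assms[unfolded W_alg_def mem_Collect_eq]
  show add: "D (p + q) = D p + D q" if "p \<in> polys n" "q \<in> polys n" for p q
    using D that by blast
  show "D p \<in> polys n" if "p \<in> polys n"
    using D that by blast
  show "D (mconst c * p) = mconst c * D p" if "p \<in> polys n"
    using D that by blast
  show "D (p * q) = D p * q + p * D q" if "p \<in> polys n" "q \<in> polys n"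
    using D that by blast
  show "D p = 0" if "p \<notin> polys n"
    using D that by blast
  show "D 0 = 0"
    using add[of 0 0] by (metis add_0 add_cancel_right_right zero_in_polys)
qed

lemma W_alg_I:
  assumes "\<And>p. p \<in> polys n \<Longrightarrow> D p \<in> polys n"
    and "\<And>p q. p \<in> polys n \<Longrightarrow> q \<in> polys n \<Longrightarrow> D (p + q) = D p + D q"
    and "\<And>c p. p \<in> polys n \<Longrightarrow> D (mconst c * p) = mconst c * D p"
    and "\<And>p q. p \<in> polys n \<Longrightarrow> q \<in> polys n \<Longrightarrow> D (p * q) = D p * q + p * D q"
    and "\<And>p. p \<notin> polys n \<Longrightarrow> D p = 0"
  shows "D \<in> W_alg n"
  unfolding W_alg_def
  by (intro CollectI conjI ballI allI impI) (fact assms)+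

lemma subspace_W_alg: "opr.subspace (W_alg n :: ('a::field mpoly \<Rightarrow> 'a mpoly) set)"
proof (rule opr.subspaceI)
  show "0 \<in> W_alg n" by (rule W_alg_I) simp_all
next
  fix D E :: "'a mpoly \<Rightarrow> 'a mpoly" assume D: "D \<in> W_alg n" and E: "E \<in> W_alg n"
  show "D + E \<in> W_alg n"
  proof (rule W_alg_I)
    fix p :: "'a mpoly" assume p: "p \<in> polys n"
    then show "(D + E) p \<in> polys n"
      by (simp add: W_alg_D(1)[OF D] W_alg_D(1)[OF E] polys_add)
    show "(D + E) (mconst c * p) = mconst c * (D + E) p" for c
      using p by (simp add: W_alg_D(3)[OF D] W_alg_D(3)[OF E] distrib_left)
    fix q :: "'a mpoly" assume q: "q \<in> polys n"
    show "(D + E) (p + q) = (D + E) p + (D + E) q"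
      unfolding plus_fun_apply W_alg_D(2)[OF D p q] W_alg_D(2)[OF E p q] by (simp add: add_ac)
    show "(D + E) (p * q) = (D + E) p * q + p * (D + E) q"
      unfolding plus_fun_apply W_alg_D(4)[OF D p q] W_alg_D(4)[OF E p q] by (simp add: algebra_simps)
  next
    fix p :: "'a mpoly" assume "p \<notin> polys n"
    then show "(D + E) p = 0"
      by (simp add: W_alg_D(5)[OF D] W_alg_D(5)[OF E])
  qed
next
  fix c :: 'a and D :: "'a mpoly \<Rightarrow> 'a mpoly" assume D: "D \<in> W_alg n"
  show "op_scale c D \<in> W_alg n"
  proof (rule W_alg_I)
    fix p :: "'a mpoly" assume p: "p \<in> polys n"
    then show "op_scale c D p \<in> polys n"
      by (simp add: op_scale_def W_alg_D(1)[OF D] polys_mult)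
    show "op_scale c D (mconst d * p) = mconst d * op_scale c D p" for d
      unfolding op_scale_def W_alg_D(3)[OF D p] by (rule mult.left_commute)
    fix q :: "'a mpoly" assume q: "q \<in> polys n"
    show "op_scale c D (p + q) = op_scale c D p + op_scale c D q"
      unfolding op_scale_def W_alg_D(2)[OF D p q] by (rule distrib_left)
    show "op_scale c D (p * q) = op_scale c D p * q + p * op_scale c D q"
      unfolding op_scale_def W_alg_D(4)[OF D p q] by (simp add: distrib_left mult_ac)
  next
    fix p :: "'a mpoly" assume "p \<notin> polys n"
    then show "op_scale c D p = 0"
      by (simp add: op_scale_def W_alg_D(5)[OF D])
  qed
qed

lemma bracket_in_W_alg:
  fixes D E :: "'a::field mpoly \<Rightarrow> 'a mpoly"
  assumes D: "D \<in> W_alg n" and E: "E \<in> W_alg n"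
  shows "bracket D E \<in> W_alg n"
proof (rule W_alg_I)
  fix p q :: "'a mpoly" assume pq: "p \<in> polys n" "q \<in> polys n"
  then show "bracket D E (p * q) = bracket D E p * q + p * bracket D E q"
    by (simp add: bracket_apply W_alg_D(1,2,4)[OF D] W_alg_D(1,2,4)[OF E] polys_mult algebra_simps)
  show "bracket D E (p + q) = bracket D E p + bracket D E q"
    using pq by (simp add: bracket_apply W_alg_D(1,2)[OF D] W_alg_D(1,2)[OF E])
next
  fix c :: 'a and p :: "'a mpoly" assume "p \<in> polys n"
  then show "bracket D E (mconst c * p) = mconst c * bracket D E p"
    by (simp add: bracket_apply W_alg_D(1,3)[OF D] W_alg_D(1,3)[OF E] right_diff_distrib)
qed (simp_all add: bracket_apply W_alg_D(1,5,6)[OF D] W_alg_D(1,5,6)[OF E] polys_diff)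

lemma lie_subalgebra_W_alg: "lie_subalgebra n (W_alg n)"
  by (simp add: lie_subalgebra_def subspace_W_alg bracket_in_W_alg)

lemma s_alg_subset_W_alg: "s_alg n \<subseteq> W_alg n"
proof
  fix D :: "'a mpoly \<Rightarrow> 'a mpoly" assume "D \<in> s_alg n"
  then obtain f where D: "D = vector_field n f"
    and f: "\<forall>i \<in> {1..n}. \<exists>a \<in> polys (i - 1). \<exists>b \<in> polys (i - 1). f i = a + mvar i * b"
    unfolding s_alg_def mem_Collect_eq by (elim exE conjE)
  have "f i \<in> polys n" if i: "i \<in> {1..n}" for i
  proof -
    from f i obtain a b where ab: "a \<in> polys (i - 1)" "b \<in> polys (i - 1)" "f i = a + mvar i * b"
      by blast
    have "polys (i - 1) \<subseteq> (polys n :: 'a mpoly set)"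
      using i by (intro polys_mono) auto
    then have "a \<in> polys n" "b \<in> polys n"
      using ab(1,2) by blast+
    moreover have "mvar i \<in> polys n"
      using i by (intro mvar_in_polys) auto
    ultimately show ?thesis
      unfolding ab(3) by (intro polys_add polys_mult)
  qed
  then show "D \<in> W_alg n"
    unfolding D by (rule vector_field_in_W_alg)
qed

end

theory Submission
  imports Defs
begin

text \<open>
  A derivation is determined by its values on the variables, and membership in \<open>s\<^sub>n\<close> only restricts
  the monomials occurring in these values.  A triangular field acts on \<open>x\<^sub>i\<close> by an affine map with
  coefficients in \<open>P\<^bsub>i-1\<^esub>\<close>.  Once the fields kill \<open>P\<^bsub>i-1\<^esub>\<close>, commutators of affine maps are
  translations and translations commute, so two derivation steps kill \<open>x\<^sub>i\<close> as well.

  For maximality, suppose that \<open>D \<in> S - s\<^sub>n\<close> with \<open>S \<supset> s\<^sub>n\<close>.  Applying the brackets with the \<open>\<partial>\<^sub>j \<in> s\<^sub>n\<close>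
  as long as the result stays outside \<open>s\<^sub>n\<close>, one may assume that all \<open>[\<partial>\<^sub>j, D]\<close> lie in \<open>s\<^sub>n\<close>.  Then
  modulo \<open>s\<^sub>n\<close> only the terms \<open>x\<^sub>l \<partial>\<^sub>k\<close> with \<open>l > k\<close> and \<open>x\<^sub>k\<^sup>2 \<partial>\<^sub>k\<close> are left in \<open>D\<close>.  Brackets with
  the torus elements \<open>x\<^sub>i \<partial>\<^sub>i\<close> isolate one of them, which together with \<open>x\<^sub>k \<partial>\<^sub>l\<close>, respectively \<open>\<partial>\<^sub>k\<close>,
  in \<open>s\<^sub>n\<close> generates a copy of \<open>sl\<^sub>2\<close> inside \<open>S\<close>.
\<close>

section \<open>Coefficients and coordinates\<close>

text \<open>Additivity is available on \<open>polys n\<close> only, so the induction over the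
  monomials of \<open>p\<close> also carries the membership of each partial sum in
  \<open>polys n\<close>.\<close>

lemma mpoly_additive_eqI:
  fixes F G :: "'a::field mpoly \<Rightarrow> 'b::comm_monoid_add"
  assumes "F 0 = 0" "G 0 = 0"
    and F: "\<And>p q. p \<in> polys n \<Longrightarrow> q \<in> polys n \<Longrightarrow> F (p + q) = F p + F q"
    and G: "\<And>p q. p \<in> polys n \<Longrightarrow> q \<in> polys n \<Longrightarrow> G (p + q) = G p + G q"
    and single: "\<And>m c. Poly_Mapping.keys m \<subseteq> {1..n} \<Longrightarrow>
      F (Poly_Mapping.single m c) = G (Poly_Mapping.single m c)"
    and p: "p \<in> polys n"
  shows "F p = G p"
proof -
  let ?s = "\<lambda>m. Poly_Mapping.single m (Poly_Mapping.lookup p m)"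
  have "sum ?s A \<in> polys n \<and> F (sum ?s A) = G (sum ?s A)"
    if "finite A" "\<forall>m \<in> A. Poly_Mapping.keys m \<subseteq> {1..n}" for A
    using that
  proof (induction A rule: finite_induct)
    case empty
    then show ?case by (simp add: assms(1,2))
  next
    case (insert m A)
    have "?s m \<in> polys n"
      using insert.prems by (simp add: polys_def)
    then show ?case
      using insert by (simp add: F G single polys_add)
  qed
  from this[of "Poly_Mapping.keys p"] show ?thesis
    using p unfolding mpoly_as_sum[symmetric] by (simp add: polys_def)
qed

text \<open>Multiplication by x_i undoes the truncated subtraction in \<open>partial\<close>, so a
  monomial becomes an eigenvector of x_i \<partial>_i with its exponent as eigenvalue. For exponent
  0 both sides vanish.\<close>

lemma mvar_mult_partial_single:
  "mvar i * partial i (Poly_Mapping.single m c) =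
     Poly_Mapping.single m (of_nat (Poly_Mapping.lookup m i) * c)"
proof (cases "Poly_Mapping.lookup m i = 0")
  case False
  then have "Poly_Mapping.single i 1 + (m - Poly_Mapping.single i 1) = m"
    by (intro poly_mapping_eqI) (auto simp: lookup_add lookup_minus lookup_single when_def)
  then show ?thesis
    by (simp add: mvar_def partial_single mult_single)
qed (simp add: partial_single)

lemma lookup_mvar_mult_partial:
  "Poly_Mapping.lookup (mvar i * partial i p) m =
     of_nat (Poly_Mapping.lookup m i) * Poly_Mapping.lookup p m"
proof -
  let ?s = "\<lambda>p m. Poly_Mapping.single m (Poly_Mapping.lookup p m)"
  let ?p = "\<Sum>m \<in> Poly_Mapping.keys p. ?s p m"
  have "Poly_Mapping.lookup (mvar i * partial i ?p) m =
     of_nat (Poly_Mapping.lookup m i) * Poly_Mapping.lookup ?p m"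
    unfolding partial_sum sum_distrib_left mvar_mult_partial_single lookup_sum
    by (rule sum.cong) (simp_all add: lookup_single when_def)
  then show ?thesis
    unfolding mpoly_as_sum[symmetric] .
qed

lemma lookup_mvar_mult:
  "Poly_Mapping.lookup (mvar i * p) (Poly_Mapping.single i 1 + m) = Poly_Mapping.lookup p m"
proof -
  let ?s = "\<lambda>p m. Poly_Mapping.single m (Poly_Mapping.lookup p m)"
  let ?p = "\<Sum>m \<in> Poly_Mapping.keys p. ?s p m"
  have "Poly_Mapping.lookup (mvar i * ?p) (Poly_Mapping.single i 1 + m) = Poly_Mapping.lookup ?p m"
    by (auto simp: sum_distrib_left lookup_sum mvar_def mult_single lookup_single when_def intro!: sum.cong)
  then show ?thesis
    unfolding mpoly_as_sum[symmetric] .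
qed

text \<open>The coefficient of \<partial>_i p at m is that of x_i \<partial>_i p at x_i m, and x_i
  \<partial>_i acts diagonally on monomials.\<close>

lemma lookup_partial:
  "Poly_Mapping.lookup (partial i p) m =
     of_nat (Suc (Poly_Mapping.lookup m i)) * Poly_Mapping.lookup p (Poly_Mapping.single i 1 + m)"
  unfolding lookup_mvar_mult[of i "partial i p", symmetric] lookup_mvar_mult_partial
  by (simp add: lookup_add)

lemma W_alg_const:
  assumes D: "D \<in> W_alg n"
  shows "D (mconst c) = 0"
proof -
  have 1: "(1 :: 'a mpoly) = mconst 1"
    by (simp add: mconst_def)
  have "D (1 * 1) = D 1 * 1 + 1 * D 1"
    by (rule W_alg_D(4)[OF D]) (simp_all add: 1)
  then have "D 1 = 0" by (metis add_cancel_right_right mult_1 mult_1_right)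
  then show ?thesis
    using W_alg_D(3)[OF D mconst_in_polys, of c 1] by (simp flip: 1)
qed

text \<open>Induction on the total degree: split off one variable and use the Leibniz rule. The sum
  stops at \<open>j\<close>, so the values on x_1, ..., x_j alone determine D on P_j; the triangular
  arguments below rest on this.\<close>

lemma W_alg_expand_single:
  assumes D: "D \<in> W_alg n" and j: "j \<le> n" and m: "Poly_Mapping.keys m \<subseteq> {1..j}"
  shows "D (Poly_Mapping.single m c) = (\<Sum>i = 1..j. D (mvar i) * partial i (Poly_Mapping.single m c))"
  using m
proof (induction "\<Sum>i = 1..j. Poly_Mapping.lookup m i" arbitrary: m)
  case 0
  then have "m = 0"
    by (intro poly_mapping_eqI) (fastforce simp: in_keys_iff)
  then show ?case
    using W_alg_const[OF D, of c] partial_const[of _ c] by (simp add: mconst_def)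
next
  case (Suc d)
  then obtain k where k: "k \<in> {1..j}" "Poly_Mapping.lookup m k \<noteq> 0"
    by (metis nat.distinct(1) sum.neutral)
  define m' where "m' = m - Poly_Mapping.single k 1"
  have m: "m = Poly_Mapping.single k 1 + m'"
    unfolding m'_def using k
    by (intro poly_mapping_eqI) (auto simp: lookup_add lookup_minus lookup_single when_def)
  have "(\<Sum>i = 1..j. Poly_Mapping.lookup m i) = Suc (\<Sum>i = 1..j. Poly_Mapping.lookup m' i)"
    using k by (simp add: m lookup_add sum.distrib lookup_single when_def)
  moreover have sub: "Poly_Mapping.keys m' \<subseteq> {1..j}"
    using Suc.prems by (auto simp: m in_keys_iff lookup_add)
  ultimately have IH: "D (Poly_Mapping.single m' c) =
      (\<Sum>i = 1..j. D (mvar i) * partial i (Poly_Mapping.single m' c))"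
    using Suc.hyps by simp
  have s: "Poly_Mapping.single m c = mvar k * Poly_Mapping.single m' c"
    by (simp add: m mvar_def mult_single)
  have "D (Poly_Mapping.single m c) =
      D (mvar k) * Poly_Mapping.single m' c + mvar k * D (Poly_Mapping.single m' c)"
    unfolding s
  proof (rule W_alg_D(4)[OF D])
    show "Poly_Mapping.single m' c \<in> polys n"
      using sub j by (auto simp: polys_def)
  qed (use k j in \<open>auto intro: mvar_in_polys\<close>)
  also have "\<dots> = (\<Sum>i = 1..j. D (mvar i) * partial i (Poly_Mapping.single m c))"
  proof -
    \<comment> \<open>The product rule splits the expansion into two sums. In this one only i = k
      survives; the other is x_k times the induction hypothesis.\<close>
    have "(\<Sum>i = 1..j. D (mvar i) * (partial i (mvar k) * Poly_Mapping.single m' c)) =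
        (\<Sum>i = 1..j. if i = k then D (mvar k) * Poly_Mapping.single m' c else 0)"
      by (intro sum.cong) (auto simp: partial_var)
    then show ?thesis
      unfolding s IH partial_mult distrib_left sum.distrib sum_distrib_left
      using k by (simp add: mult_ac)
  qed
  finally show ?case .
qed

lemma W_alg_expand:
  assumes D: "D \<in> W_alg n" and j: "j \<le> n" and p: "p \<in> polys j"
  shows "D p = (\<Sum>i = 1..j. D (mvar i) * partial i p)"
proof (rule mpoly_additive_eqI[OF _ _ _ _ _ p])
  have sub: "polys j \<subseteq> (polys n :: 'a mpoly set)"
    using j by (rule polys_mono)
  show "D (p + q) = D p + D q" if "p \<in> polys j" "q \<in> polys j" for p q
    using that sub by (intro W_alg_D(2)[OF D]) auto
qed (use W_alg_D(6)[OF D] W_alg_expand_single[OF D j] in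
    \<open>simp_all add: partial_add distrib_left sum.distrib\<close>)

lemma W_alg_eqI:
  assumes D: "D \<in> W_alg n" and E: "E \<in> W_alg n"
    and eq: "\<And>i. i \<in> {1..n} \<Longrightarrow> D (mvar i) = E (mvar i)"
  shows "D = E"
proof
  fix p
  show "D p = E p"
  proof (cases "p \<in> polys n")
    case True
    then show ?thesis
      using eq by (simp add: W_alg_expand[OF D order_refl] W_alg_expand[OF E order_refl])
  qed (simp add: W_alg_D(5)[OF D] W_alg_D(5)[OF E])
qed

lemma vector_field_mvar:
  assumes "k \<in> {1..n}"
  shows "vector_field n f (mvar k) = f k"
proof -
  have "(\<Sum>i = 1..n. f i * partial i (mvar k)) = (\<Sum>i = 1..n. if i = k then f k else 0)"
    by (intro sum.cong) (auto simp: partial_var)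
  then show ?thesis
    using assms by (simp add: vector_field_def mvar_in_polys)
qed

section \<open>The algebra \<open>s\<^sub>n\<close>\<close>

definition affine_polys :: "nat \<Rightarrow> 'a::field mpoly set" where
  "affine_polys i = {a + mvar i * b | a b. a \<in> polys (i - 1) \<and> b \<in> polys (i - 1)}"

definition affine_monom :: "nat \<Rightarrow> (nat \<Rightarrow>\<^sub>0 nat) \<Rightarrow> bool" where
  "affine_monom i m \<longleftrightarrow> Poly_Mapping.keys m \<subseteq> {1..i} \<and> Poly_Mapping.lookup m i \<le> 1"

lemma affine_polys_subset:
  assumes "1 \<le> i" "i \<le> n"
  shows "affine_polys i \<subseteq> polys n"
proof -
  have "polys (i - 1) \<subseteq> (polys n :: 'a mpoly set)"
    using assms by (intro polys_mono) auto
  then show ?thesis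
    using mvar_in_polys[OF assms] by (auto simp: affine_polys_def intro!: polys_add polys_mult)
qed

text \<open>Conversely, a polynomial p of degree at most one in x_i is a + x_i b with b =
  \<partial>_i p and a = p - x_i \<partial>_i p. Membership in s_n thereby becomes a condition on
  single coefficients.\<close>

lemma affine_polys_iff:
  assumes i: "1 \<le> i"
  shows "p \<in> affine_polys i \<longleftrightarrow> (\<forall>m \<in> Poly_Mapping.keys p. affine_monom i m)"
proof
  assume "p \<in> affine_polys i"
  then obtain a b where p: "p = a + mvar i * b" and a: "a \<in> polys (i - 1)" and b: "b \<in> polys (i - 1)"
    by (auto simp: affine_polys_def)
  have less: "x < i" if "m \<in> Poly_Mapping.keys q" "x \<in> Poly_Mapping.keys m" "q \<in> {a, b}" for m q x
    using that a b i by (fastforce simp: polys_def)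
  show "\<forall>m \<in> Poly_Mapping.keys p. affine_monom i m"
  proof
    fix m assume m: "m \<in> Poly_Mapping.keys p"
    have "Poly_Mapping.keys m \<subseteq> {1..i}"
      using affine_polys_subset[OF i order_refl] \<open>p \<in> affine_polys i\<close> m by (fastforce simp: polys_def)
    moreover consider "m \<in> Poly_Mapping.keys a" | "m \<in> Poly_Mapping.keys (mvar i * b)"
      using m Poly_Mapping.keys_add[of a "mvar i * b"] by (auto simp: p)
    then have "Poly_Mapping.lookup m i \<le> 1"
    proof cases
      case 1
      then have "i \<notin> Poly_Mapping.keys m"
        using less by blast
      then show ?thesis by (simp add: in_keys_iff)
    next
      case 2
      then obtain m' where m': "m = Poly_Mapping.single i 1 + m'" "m' \<in> Poly_Mapping.keys b"
        using keys_mult[of "mvar i" b] by (auto simp: mvar_def)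
      then have "i \<notin> Poly_Mapping.keys m'"
        using less by blast
      then show ?thesis by (simp add: m' lookup_add in_keys_iff)
    qed
    ultimately show "affine_monom i m"
      by (simp add: affine_monom_def)
  qed
next
  assume R: "\<forall>m \<in> Poly_Mapping.keys p. affine_monom i m"
  have aff: "affine_monom i m" if "Poly_Mapping.lookup p m \<noteq> 0" for m
    using R that by (simp add: in_keys_iff)
  have sub: "Poly_Mapping.keys m \<subseteq> {1..i - 1}"
    if "Poly_Mapping.keys m \<subseteq> {1..i}" "Poly_Mapping.lookup m i = 0" for m :: "nat \<Rightarrow>\<^sub>0 nat"
  proof
    fix x assume x: "x \<in> Poly_Mapping.keys m"
    then have "x \<noteq> i" using that by (auto simp: in_keys_iff)
    then show "x \<in> {1..i - 1}" using x that by fastforce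
  qed
  have "p - mvar i * partial i p \<in> polys (i - 1)"
    unfolding polys_def mem_Collect_eq
  proof
    fix m assume "m \<in> Poly_Mapping.keys (p - mvar i * partial i p)"
    \<comment> \<open>The coefficient is (1 - e) times that of p, where e is the exponent of x_i;
      terms with e = 1 cancel and only e = 0 is left.\<close>
    then have *: "Poly_Mapping.lookup p m - of_nat (Poly_Mapping.lookup m i) * Poly_Mapping.lookup p m \<noteq> 0"
      by (simp add: in_keys_iff lookup_minus lookup_mvar_mult_partial)
    then have "affine_monom i m" by (intro aff) auto
    moreover from * have "Poly_Mapping.lookup m i \<noteq> 1" by auto
    ultimately show "Poly_Mapping.keys m \<subseteq> {1..i - 1}"
      by (intro sub) (auto simp: affine_monom_def)
  qed
  moreover have "partial i p \<in> polys (i - 1)"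
    unfolding polys_def mem_Collect_eq
  proof
    fix m assume "m \<in> Poly_Mapping.keys (partial i p)"
    then have "affine_monom i (Poly_Mapping.single i 1 + m)"
      by (intro aff) (auto simp: in_keys_iff lookup_partial)
    then show "Poly_Mapping.keys m \<subseteq> {1..i - 1}"
      by (intro sub) (auto simp: affine_monom_def in_keys_iff lookup_add)
  qed
  ultimately show "p \<in> affine_polys i"
    unfolding affine_polys_def mem_Collect_eq
    by (intro exI[of _ "p - mvar i * partial i p"] exI[of _ "partial i p"]) simp
qed

lemma s_alg_iff:
  "D \<in> s_alg n \<longleftrightarrow> D \<in> W_alg n \<and> (\<forall>i \<in> {1..n}. D (mvar i) \<in> affine_polys i)"
proof
  assume D: "D \<in> s_alg n"
  then obtain f where "D = vector_field n f" "\<forall>i \<in> {1..n}. f i \<in> affine_polys i"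
    unfolding s_alg_def affine_polys_def by blast
  then show "D \<in> W_alg n \<and> (\<forall>i \<in> {1..n}. D (mvar i) \<in> affine_polys i)"
    using D s_alg_subset_W_alg by (auto simp: vector_field_mvar)
next
  assume R: "D \<in> W_alg n \<and> (\<forall>i \<in> {1..n}. D (mvar i) \<in> affine_polys i)"
  have sub: "affine_polys i \<subseteq> (polys n :: 'a mpoly set)" if "i \<in> {1..n}" for i
    using that by (intro affine_polys_subset) auto
  have "D = vector_field n (\<lambda>i. D (mvar i))"
  proof (intro W_alg_eqI[of _ n] vector_field_in_W_alg)
    show "D (mvar i) \<in> polys n" if "i \<in> {1..n}" for i
      using R sub[OF that] that by blast
  qed (use R in \<open>simp_all add: vector_field_mvar\<close>)
  then show "D \<in> s_alg n"
    using R unfolding s_alg_def affine_polys_def by blast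
qed

text \<open>Triangularity: on P_j only the values D x_i with i \<le> j enter, and these lie in P_i,
  hence in P_j.\<close>

lemma s_alg_polys:
  assumes D: "D \<in> s_alg n" and j: "j \<le> n" and p: "p \<in> polys j"
  shows "D p \<in> polys j"
proof -
  have "D (mvar i) \<in> polys j" if "i \<in> {1..j}" for i
    using D that j affine_polys_subset[of i j] by (auto simp: s_alg_iff)
  then show ?thesis
    using W_alg_expand[OF _ j p, of D] D p
    by (auto simp: s_alg_iff intro!: polys_sum polys_mult partial_in_polys)
qed

lemma affine_polys_diff:
  assumes "p \<in> affine_polys i" "q \<in> affine_polys i"
  shows "p - q \<in> affine_polys i"
proof -
  obtain a b c d where "p = a + mvar i * b" "q = c + mvar i * d"
    and P: "a \<in> polys (i - 1)" "b \<in> polys (i - 1)" "c \<in> polys (i - 1)" "d \<in> polys (i - 1)"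
    using assms by (auto simp: affine_polys_def)
  then have "p - q = (a - c) + mvar i * (b - d)"
    by (simp add: algebra_simps)
  then show ?thesis
    unfolding affine_polys_def using P polys_diff by blast
qed

lemma subspace_s_alg: "opr.subspace (s_alg n)"
proof (rule opr.subspaceI)
  show "0 \<in> s_alg n"
    by (auto simp: s_alg_iff opr.subspace_0 subspace_W_alg affine_polys_iff)
  fix D E :: "'a mpoly \<Rightarrow> 'a mpoly" assume D: "D \<in> s_alg n"
  show "D + E \<in> s_alg n" if E: "E \<in> s_alg n"
  proof -
    have "D (mvar i) + E (mvar i) \<in> affine_polys i" if "i \<in> {1..n}" for i
      using D E that Poly_Mapping.keys_add[of "D (mvar i)" "E (mvar i)"]
      by (fastforce simp: s_alg_iff affine_polys_iff)
    then show ?thesis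
      using D E by (simp add: s_alg_iff opr.subspace_add subspace_W_alg)
  qed
  show "op_scale c D \<in> s_alg n" for c
  proof -
    have "Poly_Mapping.keys (op_scale c D p) \<subseteq> Poly_Mapping.keys (D p)" for p
      using keys_mult[of "mconst c" "D p"] by (auto simp: op_scale_def mconst_def split: if_splits)
    then show ?thesis
      using D by (fastforce simp: s_alg_iff opr.subspace_scale subspace_W_alg affine_polys_iff)
  qed
qed

text \<open>With D x_i = a + x_i b, the Leibniz rule gives D (c + x_i d) = (D c + a d) + x_i (b d +
  D d), and triangularity keeps D c and D d in P_{i-1}. Closure of s_n under brackets follows at
  once.\<close>

lemma s_alg_affine_polys:
  assumes D: "D \<in> s_alg n" and i: "i \<in> {1..n}" and p: "p \<in> affine_polys i"
  shows "D p \<in> affine_polys i"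
proof -
  have W: "D \<in> W_alg n" and "D (mvar i) \<in> affine_polys i"
    using D i by (auto simp: s_alg_iff)
  then obtain a b where ab: "D (mvar i) = a + mvar i * b" "a \<in> polys (i - 1)" "b \<in> polys (i - 1)"
    by (auto simp: affine_polys_def)
  obtain c d where cd: "p = c + mvar i * d" "c \<in> polys (i - 1)" "d \<in> polys (i - 1)"
    using p by (auto simp: affine_polys_def)
  have "polys (i - 1) \<subseteq> (polys n :: 'a mpoly set)"
    using i by (intro polys_mono) auto
  then have n: "c \<in> polys n" "d \<in> polys n" "mvar i \<in> (polys n :: 'a mpoly set)"
    using cd i by (auto intro: mvar_in_polys)
  have "D p = (D c + a * d) + mvar i * (b * d + D d)"
    using n by (simp add: cd(1) W_alg_D(2,4)[OF W] polys_mult ab(1) algebra_simps)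
  moreover have "D c \<in> polys (i - 1)" "D d \<in> polys (i - 1)"
    using cd i by (auto intro!: s_alg_polys[OF D])
  ultimately show ?thesis
    unfolding affine_polys_def using ab(2,3) cd(2,3) polys_add polys_mult by blast
qed

lemma bracket_s_alg:
  assumes D: "D \<in> s_alg n" and E: "E \<in> s_alg n"
  shows "bracket D E \<in> s_alg n"
proof -
  have "bracket D E (mvar i) \<in> affine_polys i" if i: "i \<in> {1..n}" for i
    unfolding bracket_apply
  proof (intro affine_polys_diff)
    show "D (E (mvar i)) \<in> affine_polys i"
      using E i by (intro s_alg_affine_polys[OF D i]) (simp add: s_alg_iff)
    show "E (D (mvar i)) \<in> affine_polys i"
      using D i by (intro s_alg_affine_polys[OF E i]) (simp add: s_alg_iff)
  qed
  then show ?thesis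
    using D E by (simp add: s_alg_iff bracket_in_W_alg)
qed

lemma lie_subalgebra_s_alg: "lie_subalgebra n (s_alg n)"
  by (simp add: lie_subalgebra_def s_alg_subset_W_alg subspace_s_alg bracket_s_alg)

section \<open>Solvability of s_n\<close>

text \<open>Two steps are spent on each variable: from stage 2i - 1 on, x_i is sent into P_{i-1} (a
  translation); from stage 2i on, it is killed.\<close>

definition s_filt :: "nat \<Rightarrow> nat \<Rightarrow> ('a::field mpoly \<Rightarrow> 'a mpoly) set" where
  "s_filt n k = {D \<in> s_alg n. \<forall>i \<in> {1..n}.
     (2 * i \<le> k \<longrightarrow> D (mvar i) = 0) \<and> (2 * i \<le> Suc k \<longrightarrow> D (mvar i) \<in> polys (i - 1))}"

lemma subspace_s_filt: "opr.subspace (s_filt n k)"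
  unfolding s_filt_def
  by (rule opr.subspaceI)
    (auto simp: opr.subspace_0 opr.subspace_add opr.subspace_scale subspace_s_alg
      op_scale_def[THEN fun_cong] intro: polys_add polys_mult)

lemma s_filt_kills_polys:
  assumes D: "D \<in> s_filt n k" and i: "2 * i \<le> k" "i \<le> n" and p: "p \<in> polys i"
  shows "D p = 0"
proof -
  have "D \<in> W_alg n"
    using D by (simp add: s_filt_def s_alg_iff)
  then show ?thesis
    using W_alg_expand[OF _ i(2) p, of D] D i by (simp add: s_filt_def)
qed

text \<open>If D x_i and E x_i lie in P_{i-1}, the bracket kills x_i, because both fields already
  kill P_{i-1}. One stage earlier both are affine in x_i, and the linear parts cancel in the
  commutator.\<close>

lemma bracket_s_filt:
  assumes D: "D \<in> s_filt n k" and E: "E \<in> s_filt n k"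
  shows "bracket D E \<in> s_filt n (Suc k)"
proof -
  have s: "D \<in> s_alg n" "E \<in> s_alg n"
    using D E by (auto simp: s_filt_def)
  then have W: "D \<in> W_alg n" "E \<in> W_alg n"
    by (auto simp: s_alg_iff)
  have "bracket D E (mvar i) = 0" if i: "i \<in> {1..n}" "2 * i \<le> Suc k" for i
  proof -
    have "D (mvar i) \<in> polys (i - 1)" "E (mvar i) \<in> polys (i - 1)"
      using D E i by (auto simp: s_filt_def)
    moreover have "2 * (i - 1) \<le> k" "i - 1 \<le> n"
      using i by auto
    ultimately show ?thesis
      using s_filt_kills_polys[OF D] s_filt_kills_polys[OF E] by (simp add: bracket_apply)
  qed
  moreover have "bracket D E (mvar i) \<in> polys (i - 1)" if i: "i \<in> {1..n}" "2 * i \<le> Suc (Suc k)" for i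
  proof -
    have "D (mvar i) \<in> affine_polys i" "E (mvar i) \<in> affine_polys i"
      using s i by (auto simp: s_alg_iff)
    then obtain a b c d where
      ab: "D (mvar i) = a + mvar i * b" "a \<in> polys (i - 1)" "b \<in> polys (i - 1)" and
      cd: "E (mvar i) = c + mvar i * d" "c \<in> polys (i - 1)" "d \<in> polys (i - 1)"
      unfolding affine_polys_def by blast
    have sub: "polys (i - 1) \<subseteq> (polys n :: 'a mpoly set)"
      using i by (intro polys_mono) auto
    \<comment> \<open>A field that kills P_{i-1} is P_{i-1}-linear.\<close>
    have *: "F (u + mvar i * v) = F (mvar i) * v"
      if F: "F \<in> s_filt n k" and uv: "u \<in> polys (i - 1)" "v \<in> polys (i - 1)"
      for F :: "'a mpoly \<Rightarrow> 'a mpoly" and u v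
    proof -
      have "u \<in> polys n" "v \<in> polys n" "mvar i \<in> (polys n :: 'a mpoly set)"
        using uv sub i by (auto intro: mvar_in_polys)
      moreover have "F \<in> W_alg n"
        using F by (simp add: s_filt_def s_alg_iff)
      moreover have "2 * (i - 1) \<le> k" "i - 1 \<le> n"
        using i by auto
      then have "F u = 0" "F v = 0"
        using uv s_filt_kills_polys[OF F] by auto
      ultimately show ?thesis
        by (simp add: W_alg_D(2,4) polys_mult)
    qed
    have "bracket D E (mvar i) = a * d - c * b"
      using *[OF D cd(2,3)] *[OF E ab(2,3)] by (simp add: bracket_apply ab(1) cd(1) algebra_simps)
    then show ?thesis
      using ab cd by (auto intro!: polys_diff polys_mult)
  qed
  ultimately show ?thesis
    using bracket_s_alg[OF s] by (simp add: s_filt_def)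
qed

lemma derived_series_s_alg_subset: "derived_series (s_alg n) k \<subseteq> s_filt n k"
proof (induction k)
  case 0
  then show ?case by (auto simp: s_filt_def)
next
  case (Suc k)
  then show ?case
    unfolding derived_series.simps
    by (intro opr.span_minimal subspace_s_filt) (auto intro!: bracket_s_filt)
qed

lemma lie_solvable_s_alg: "lie_solvable (s_alg n)"
proof -
  \<comment> \<open>Stage 2n kills every variable; the successor presents the last term as a span,
    which contains 0.\<close>
  let ?k = "Suc (2 * n)"
  have filt: "D = 0" if "D \<in> s_filt n ?k" for D :: "'a mpoly \<Rightarrow> 'a mpoly"
    using that
    by (intro W_alg_eqI[of _ n]) (auto simp: s_filt_def s_alg_iff opr.subspace_0 subspace_W_alg)
  have "derived_series (s_alg n) ?k \<subseteq> {0 :: 'a mpoly \<Rightarrow> 'a mpoly}"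
  proof
    fix D :: "'a mpoly \<Rightarrow> 'a mpoly" assume "D \<in> derived_series (s_alg n) ?k"
    then have "D = 0"
      by (rule filt[OF subsetD[OF derived_series_s_alg_subset]])
    then show "D \<in> {0}" by (simp only: singleton_iff)
  qed
  moreover have "{0 :: 'a mpoly \<Rightarrow> 'a mpoly} \<subseteq> derived_series (s_alg n) ?k"
    by (simp add: opr.span_zero)
  ultimately have "derived_series (s_alg n) ?k = {0 :: 'a mpoly \<Rightarrow> 'a mpoly}"
    by (rule subset_antisym)
  then show ?thesis
    unfolding lie_solvable_def by (rule exI)
qed

section \<open>Copies of \<open>sl\<^sub>2\<close>\<close>

text \<open>Each of e, f and h = [e, f] is, up to a nonzero scalar, a bracket of two of the three,
  so all three survive in every derived term. Since e is nonzero, no term is trivial.\<close>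

lemma not_solvable_if_sl2:
  assumes L: "e \<in> L" "f \<in> L" "bracket e f \<in> L"
    and e: "bracket (bracket e f) e = op_scale c e" and c: "c \<noteq> 0"
    and f: "bracket (bracket e f) f = op_scale d f" and d: "d \<noteq> 0"
    and nz: "e \<noteq> 0"
  shows "\<not> lie_solvable L"
proof -
  have "e \<in> derived_series L k \<and> f \<in> derived_series L k \<and> bracket e f \<in> derived_series L k" for k
  proof (induction k)
    case 0
    then show ?case using L by simp
  next
    case (Suc k)
    then have "bracket e f \<in> derived_series L (Suc k)"
      "op_scale c e \<in> derived_series L (Suc k)" "op_scale d f \<in> derived_series L (Suc k)"
      unfolding derived_series.simps e[symmetric] f[symmetric]
      by (auto intro!: opr.span_base)
    moreover from this have "op_scale (1 / c) (op_scale c e) \<in> derived_series L (Suc k)"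
      "op_scale (1 / d) (op_scale d f) \<in> derived_series L (Suc k)"
      unfolding derived_series.simps by (auto intro!: opr.span_scale simp del: opr.scale_scale)
    ultimately show ?case
      using c d by simp
  qed
  then show ?thesis
    using nz by (auto simp: lie_solvable_def)
qed

text \<open>For \<open>i\<close> in \<open>{1..n}\<close> this is the field p \<partial>_i. The
  torus elements and the generators of both copies of sl_2 have this form.\<close>

definition mono_field :: "nat \<Rightarrow> 'a::field mpoly \<Rightarrow> nat \<Rightarrow> 'a mpoly \<Rightarrow> 'a mpoly" where
  "mono_field n p i = vector_field n (\<lambda>k. if k = i then p else 0)"

lemma mono_field_apply:
  assumes "i \<in> {1..n}" "q \<in> polys n"
  shows "mono_field n p i q = p * partial i q"
proof -
  have "(\<Sum>k = 1..n. (if k = i then p else 0) * partial k q) =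
      (\<Sum>k = 1..n. if k = i then p * partial i q else 0)"
    by (intro sum.cong) auto
  then show ?thesis
    using assms by (simp add: mono_field_def vector_field_def)
qed

lemma mono_field_mvar:
  "k \<in> {1..n} \<Longrightarrow> mono_field n p i (mvar k) = (if k = i then p else 0)"
  by (simp add: mono_field_def vector_field_mvar)

lemma mono_field_W_alg: "p \<in> polys n \<Longrightarrow> mono_field n p i \<in> W_alg n"
  unfolding mono_field_def by (rule vector_field_in_W_alg) simp

lemma zero_in_affine_polys [simp]: "0 \<in> affine_polys i"
  unfolding affine_polys_def mem_Collect_eq by (intro exI[of _ 0]) simp

lemma mono_field_s_alg: "p \<in> affine_polys i \<Longrightarrow> i \<in> {1..n} \<Longrightarrow> mono_field n p i \<in> s_alg n"
  using affine_polys_subset[of i n] by (auto simp: s_alg_iff mono_field_W_alg mono_field_mvar)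

lemma W_alg_diff:
  assumes "D \<in> W_alg n" "p \<in> polys n" "q \<in> polys n"
  shows "D (p - q) = D p - D q"
proof -
  have "D ((p - q) + q) = D (p - q) + D q"
    using assms by (intro W_alg_D(2)) auto
  then show ?thesis by simp
qed

lemma mconst_add: "mconst (a + b) = mconst a + mconst b"
  by (simp add: mconst_def single_add)

lemma mconst_1: "mconst 1 = 1"
  by (simp add: mconst_def)

lemma mconst_2: "mconst 2 = 2"
  using mconst_add[of 1 1] by (simp add: mconst_1)

lemma mconst_uminus: "mconst (- a) = - mconst a"
  by (simp add: mconst_def single_uminus)

text \<open>For e = x_j \<partial>_i and f = x_i \<partial>_j one gets h = x_j \<partial>_j - x_i
  \<partial>_i, with [h, e] = 2e and [h, f] = -2f. Characteristic zero makes 2 invertible.\<close>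

lemma not_solvable_linear:
  fixes L :: "('a::field_char_0 mpoly \<Rightarrow> 'a mpoly) set"
  assumes L: "lie_subalgebra n L" and ij: "i \<in> {1..n}" "j \<in> {1..n}" "i \<noteq> j"
    and e: "mono_field n (mvar j) i \<in> L" and f: "mono_field n (mvar i) j \<in> L"
  shows "\<not> lie_solvable L"
proof (rule not_solvable_if_sl2[OF e f, where c = 2 and d = "-2"])
  let ?e = "mono_field n (mvar j) i :: 'a mpoly \<Rightarrow> 'a mpoly"
  let ?f = "mono_field n (mvar i) j :: 'a mpoly \<Rightarrow> 'a mpoly"
  have P: "mvar i \<in> (polys n :: 'a mpoly set)" "mvar j \<in> (polys n :: 'a mpoly set)"
    using ij by (auto intro: mvar_in_polys)
  then have W: "?e \<in> W_alg n" "?f \<in> W_alg n"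
    by (simp_all add: mono_field_W_alg)
  note [simp] = mono_field_mvar W[THEN W_alg_D(6)] bracket_apply op_scale_def mconst_2 mconst_uminus
    W_alg_diff[OF W(1)] W_alg_diff[OF W(2)] P
  show "bracket ?e ?f \<in> L"
    using L e f by (simp add: lie_subalgebra_def)
  show "bracket (bracket ?e ?f) ?e = op_scale 2 ?e"
    using ij by (intro W_alg_eqI[of _ n] bracket_in_W_alg opr.subspace_scale[OF subspace_W_alg] W) auto
  show "bracket (bracket ?e ?f) ?f = op_scale (-2) ?f"
    using ij by (intro W_alg_eqI[of _ n] bracket_in_W_alg opr.subspace_scale[OF subspace_W_alg] W) auto
  \<comment> \<open>The value x_j of e at x_i is nonzero because its derivative by x_j is 1.\<close>
  have "partial j (?e (mvar i)) \<noteq> 0"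
    using ij by (simp add: partial_var)
  then show "?e \<noteq> 0" by auto
qed simp_all

text \<open>For e = \<partial>_i and f = x_i^2 \<partial>_i one gets h = 2 x_i \<partial>_i, with
  [h, e] = -2e and [h, f] = 2f.\<close>

lemma not_solvable_quadratic:
  fixes L :: "('a::field_char_0 mpoly \<Rightarrow> 'a mpoly) set"
  assumes L: "lie_subalgebra n L" and i: "i \<in> {1..n}"
    and e: "mono_field n 1 i \<in> L" and f: "mono_field n (mvar i * mvar i) i \<in> L"
  shows "\<not> lie_solvable L"
proof (rule not_solvable_if_sl2[OF e f, where c = "-2" and d = 2])
  let ?e = "mono_field n 1 i :: 'a mpoly \<Rightarrow> 'a mpoly"
  let ?f = "mono_field n (mvar i * mvar i) i :: 'a mpoly \<Rightarrow> 'a mpoly"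
  have P: "mvar i \<in> (polys n :: 'a mpoly set)" "1 \<in> (polys n :: 'a mpoly set)"
    using i mconst_in_polys[of 1 n] by (auto intro: mvar_in_polys simp: mconst_1)
  then have W: "?e \<in> W_alg n" "?f \<in> W_alg n"
    by (simp_all add: mono_field_W_alg polys_mult)
  have one: "partial k (1 :: 'a mpoly) = 0" for k
    using partial_const[of k 1] by (simp add: mconst_1)
  have two: "2 * mvar i \<in> (polys n :: 'a mpoly set)" "partial i (2 * mvar i :: 'a mpoly) = 2"
    unfolding mult_2 using P by (simp_all only: polys_add partial_add partial_var) simp
  have e_mult: "?e (mvar i * mvar i) = 2 * mvar i" "?e (2 * mvar i) = 2"
    "?f (2 * mvar i) = 2 * (mvar i * mvar i)"
    using P i by (simp_all add: mono_field_apply[OF i] polys_mult partial_mult[of i "mvar i" "mvar i"] partial_var two)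
  have f_mult: "?e 1 = 0" "?f 1 = 0"
    using P i by (simp_all add: mono_field_apply one)
  have h: "bracket ?e ?f \<in> W_alg n" by (intro bracket_in_W_alg W)
  \<comment> \<open>These values of h, together with its vanishing on the other variables
    (\<open>h0\<close>), are all that the double brackets require of it.\<close>
  have h_mult: "bracket ?e ?f 1 = 0" "bracket ?e ?f (mvar i) = 2 * mvar i"
    "bracket ?e ?f (mvar i * mvar i) = 4 * (mvar i * mvar i)"
    using W_alg_const[OF h, of 1] W_alg_D(4)[OF h P(1) P(1)] i
    by (auto simp: mconst_1 bracket_apply mono_field_mvar e_mult f_mult)
  note [simp] = mono_field_mvar W[THEN W_alg_D(6)] h[THEN W_alg_D(6)] bracket_apply[of "bracket _ _"]
    op_scale_def mconst_2 mconst_uminus e_mult f_mult h_mult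
  have h0: "bracket ?e ?f (mvar k) = 0" if "k \<in> {1..n}" "k \<noteq> i" for k
    using that by (simp add: bracket_apply[of ?e])
  show "bracket ?e ?f \<in> L"
    using L e f by (simp add: lie_subalgebra_def)
  show "bracket (bracket ?e ?f) ?e = op_scale (-2) ?e"
    using i h0 by (intro W_alg_eqI[of _ n] bracket_in_W_alg opr.subspace_scale[OF subspace_W_alg] W) auto
  show "bracket (bracket ?e ?f) ?f = op_scale 2 ?f"
    using i h0 by (intro W_alg_eqI[of _ n] bracket_in_W_alg opr.subspace_scale[OF subspace_W_alg] W)
      auto
  have "?e (mvar i) \<noteq> 0"
    using i by simp
  then show "?e \<noteq> 0" by auto
qed simp_all

section \<open>Maximality\<close>

text \<open>The other half of the bracket applies D to a constant and vanishes. Bracketing with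
  \<partial>_j thus differentiates every component and lowers its degree.\<close>

lemma bracket_mono_field_1:
  assumes D: "D \<in> W_alg n" and i: "i \<in> {1..n}" and j: "j \<in> {1..n}"
  shows "bracket (mono_field n 1 j) D (mvar i) = partial j (D (mvar i))"
proof -
  have "D (mvar i) \<in> polys n"
    using i by (intro W_alg_D(1)[OF D] mvar_in_polys) auto
  then show ?thesis
    using W_alg_const[OF D, of 1] W_alg_D(6)[OF D] i j
    by (simp add: bracket_apply mono_field_mvar mono_field_apply mconst_1)
qed

text \<open>The term x^m \<partial>_k is an eigenvector of the bracket with x_j \<partial>_j, of
  weight m_j - \<delta>_{jk}. Such brackets therefore filter terms by weight.\<close>

lemma lookup_bracket_torus:
  assumes D: "D \<in> W_alg n" and j: "j \<in> {1..n}" and k: "k \<in> {1..n}"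
  shows "Poly_Mapping.lookup (bracket (mono_field n (mvar j) j) D (mvar k)) m =
    (of_nat (Poly_Mapping.lookup m j) - (if k = j then 1 else 0)) * Poly_Mapping.lookup (D (mvar k)) m"
proof -
  have "D (mvar k) \<in> polys n"
    using k by (intro W_alg_D(1)[OF D] mvar_in_polys) auto
  then show ?thesis
    using j k W_alg_D(6)[OF D]
    by (simp add: bracket_apply mono_field_mvar mono_field_apply lookup_minus
        lookup_mvar_mult_partial left_diff_distrib)
qed

lemma s_algI_lookup:
  assumes "D \<in> W_alg n"
    and "\<And>i m. i \<in> {1..n} \<Longrightarrow> \<not> affine_monom i m \<Longrightarrow> Poly_Mapping.lookup (D (mvar i)) m = 0"
  shows "D \<in> s_alg n"
proof -
  have "D (mvar i) \<in> affine_polys i" if "i \<in> {1..n}" for i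
    using assms(2)[OF that] that by (auto simp: affine_polys_iff in_keys_iff)
  then show ?thesis
    using assms(1) by (simp add: s_alg_iff)
qed

section \<open>Elements that every \<partial>_j brings into s_n\<close>

text \<open>A monomial is not affine because it contains some x_l with l > i or the square of x_i.
  Any further factor could be divided off without repairing this, so a minimal one has none. Index 0
  is excluded because it names no variable and yet would violate
  \<open>affine_monom\<close>.\<close>

lemma minimal_nonaffine_monom:
  assumes m: "\<not> affine_monom i m" "0 \<notin> Poly_Mapping.keys m"
    and min: "\<And>j. j \<in> Poly_Mapping.keys m \<Longrightarrow> affine_monom i (m - Poly_Mapping.single j 1)"
  shows "(\<exists>l > i. m = Poly_Mapping.single l 1) \<or> m = Poly_Mapping.single i 2"
proof (cases "Poly_Mapping.keys m \<subseteq> {1..i}")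
  case True
  then have two: "2 \<le> Poly_Mapping.lookup m i"
    using m by (simp add: affine_monom_def)
  have "m = Poly_Mapping.single i 2"
  proof (rule ccontr)
    assume "m \<noteq> Poly_Mapping.single i 2"
    \<comment> \<open>At \<open>k\<close> the monomial exceeds x_i^2, so division by x_k leaves the
      exponent of x_i at least 2.\<close>
    then obtain k where k: "Poly_Mapping.lookup m k \<noteq> Poly_Mapping.lookup (Poly_Mapping.single i 2) k"
      by (meson poly_mapping_eqI)
    then have "k \<in> Poly_Mapping.keys m"
      using two by (auto simp: in_keys_iff lookup_single when_def split: if_splits)
    then have "Poly_Mapping.lookup (m - Poly_Mapping.single k 1) i \<le> 1"
      using min by (simp add: affine_monom_def)
    then show False
      using k two by (auto simp: lookup_minus lookup_single when_def split: if_splits)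
  qed
  then show ?thesis ..
next
  case False
  then obtain l where l: "l \<in> Poly_Mapping.keys m" "i < l"
    using m(2) by (metis One_nat_def Suc_leI atLeastAtMost_iff gr0I not_le subsetI)
  have "m = Poly_Mapping.single l 1"
  proof (rule ccontr)
    assume "m \<noteq> Poly_Mapping.single l 1"
    then obtain k where k: "Poly_Mapping.lookup m k \<noteq> Poly_Mapping.lookup (Poly_Mapping.single l 1) k"
      by (meson poly_mapping_eqI)
    then have "k \<in> Poly_Mapping.keys m"
      using l by (auto simp: in_keys_iff lookup_single when_def split: if_splits)
    then have "l \<notin> Poly_Mapping.keys (m - Poly_Mapping.single k 1)"
      using min l by (fastforce simp: affine_monom_def)
    then show False
      using k l by (auto simp: in_keys_iff lookup_minus lookup_single when_def split: if_splits)
  qed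
  then show ?thesis using l by blast
qed

text \<open>If x_j divides m, then m / x_j occurs in \<partial>_j (D x_i), since the exponent of x_j
  is nonzero in characteristic zero. This derivative is affine by hypothesis, so m is a minimal
  non-affine monomial.\<close>

lemma critical_monomials:
  fixes D :: "'a::field_char_0 mpoly \<Rightarrow> 'a mpoly"
  assumes D: "D \<in> W_alg n" and crit: "\<And>j. j \<in> {1..n} \<Longrightarrow> bracket (mono_field n 1 j) D \<in> s_alg n"
    and i: "i \<in> {1..n}" and nz: "Poly_Mapping.lookup (D (mvar i)) m \<noteq> 0" and m: "\<not> affine_monom i m"
  shows "(\<exists>l \<in> {1..n}. i < l \<and> m = Poly_Mapping.single l 1) \<or> m = Poly_Mapping.single i 2"
proof -
  have "D (mvar i) \<in> polys n"
    using i by (intro W_alg_D(1)[OF D] mvar_in_polys) auto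
  then have keys: "Poly_Mapping.keys m \<subseteq> {1..n}"
    using nz by (simp add: polys_def in_keys_iff)
  have "affine_monom i (m - Poly_Mapping.single j 1)" if j: "j \<in> Poly_Mapping.keys m" for j
  proof -
    have "Poly_Mapping.single j 1 + (m - Poly_Mapping.single j 1) = m"
      using j by (intro poly_mapping_eqI) (auto simp: in_keys_iff lookup_add lookup_minus lookup_single when_def)
    then have "m - Poly_Mapping.single j 1 \<in> Poly_Mapping.keys (partial j (D (mvar i)))"
      using nz unfolding in_keys_iff lookup_partial by (simp del: of_nat_Suc)
    moreover have "j \<in> {1..n}"
      using j keys by blast
    then have "partial j (D (mvar i)) \<in> affine_polys i"
      using crit[of j] i by (simp flip: bracket_mono_field_1[OF D i] add: s_alg_iff)
    then have "\<forall>m' \<in> Poly_Mapping.keys (partial j (D (mvar i))). affine_monom i m'"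
      using i by (subst (asm) affine_polys_iff) auto
    ultimately show ?thesis
      by (rule bspec[rotated])
  qed
  moreover have "0 \<notin> Poly_Mapping.keys m"
    using keys by auto
  ultimately consider l where "i < l" "m = Poly_Mapping.single l 1" | "m = Poly_Mapping.single i 2"
    using minimal_nonaffine_monom[OF m] by blast
  then show ?thesis
    using keys by cases auto
qed

lemma mconst_mult_mvar: "mconst c * mvar j = Poly_Mapping.single (Poly_Mapping.single j 1) c"
  by (simp add: mconst_def mvar_def mult_single)

lemma mconst_mult_mvar_square:
  "mconst c * (mvar i * mvar i) = Poly_Mapping.single (Poly_Mapping.single i 2) c"
  by (simp add: mconst_def mvar_def mult_single numeral_2_eq_2 flip: single_add)

text \<open>Modulo s_n only the non-affine coefficients count: E and c p \<partial>_i differ by an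
  element of s_n, which lies in L, and c can be divided out.\<close>

lemma mono_field_mem_of_diff:
  assumes L: "lie_subalgebra n L" "s_alg n \<subseteq> L" and E: "E \<in> L" and p: "p \<in> polys n" and i: "i \<in> {1..n}"
    and diff: "\<And>k m. k \<in> {1..n} \<Longrightarrow> \<not> affine_monom k m \<Longrightarrow>
      Poly_Mapping.lookup (E (mvar k)) m = (if k = i then Poly_Mapping.lookup (mconst c * p) m else 0)"
    and c: "c \<noteq> 0"
  shows "mono_field n p i \<in> L"
proof -
  let ?X = "op_scale c (mono_field n p i)"
  note sub = L(1)[unfolded lie_subalgebra_def, THEN conjunct2, THEN conjunct1]
  have W: "E \<in> W_alg n" "?X \<in> W_alg n"
    using L E p by (auto simp: lie_subalgebra_def mono_field_W_alg opr.subspace_scale[OF subspace_W_alg])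
  have "E - ?X \<in> s_alg n"
    using diff by (intro s_algI_lookup opr.subspace_diff[OF subspace_W_alg] W)
      (simp add: lookup_minus op_scale_def mono_field_mvar)
  then have "E - (E - ?X) \<in> L"
    by (intro opr.subspace_diff[OF sub] E subsetD[OF L(2)])
  then have "?X \<in> L"
    by (simp only: diff_diff_eq2 add_diff_cancel_left')
  then have "op_scale (1 / c) ?X \<in> L"
    by (rule opr.subspace_scale[OF sub])
  then show ?thesis
    using c by simp
qed

lemma critical_not_solvable:
  fixes L :: "('a::field_char_0 mpoly \<Rightarrow> 'a mpoly) set"
  assumes L: "lie_subalgebra n L" "s_alg n \<subseteq> L" and D: "D \<in> L" "D \<notin> s_alg n"
    and crit: "\<And>j. j \<in> {1..n} \<Longrightarrow> bracket (mono_field n 1 j) D \<in> s_alg n"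
  shows "\<not> lie_solvable L"
proof -
  let ?T = "\<lambda>j. mono_field n (mvar j) j :: 'a mpoly \<Rightarrow> 'a mpoly"
  have W: "D \<in> W_alg n"
    using L D by (auto simp: lie_subalgebra_def)
  have mvar_aff: "mvar k \<in> (affine_polys l :: 'a mpoly set)" if "1 \<le> k" "k \<le> l" for k l
    using that by (auto simp: affine_polys_iff affine_monom_def mvar_def lookup_single when_def)
  have one_aff: "1 \<in> (affine_polys l :: 'a mpoly set)" if "1 \<le> l" for l
    using that by (auto simp: affine_polys_iff affine_monom_def simp flip: single_one)
  have T: "?T j \<in> s_alg n" if "j \<in> {1..n}" for j
    using that by (intro mono_field_s_alg mvar_aff) auto
  have bracket_T: "bracket (?T j) E \<in> L" if "j \<in> {1..n}" "E \<in> L" for j E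
    using that L T[of j] by (auto simp: lie_subalgebra_def)
  note critm = critical_monomials[OF W crit]
  show ?thesis
  proof (cases "\<exists>i \<in> {1..n}. \<exists>l \<in> {1..n}. i < l \<and>
      Poly_Mapping.lookup (D (mvar i)) (Poly_Mapping.single l 1) \<noteq> 0")
    case True
    then obtain i l where il: "i \<in> {1..n}" "l \<in> {1..n}" "i < l"
      and nz: "Poly_Mapping.lookup (D (mvar i)) (Poly_Mapping.single l 1) \<noteq> 0"
      by blast
    \<comment> \<open>The term x_l \<partial>_i has weights 1 and -1 under x_l \<partial>_l and x_i
      \<partial>_i, so its coefficient changes sign. Every other non-affine term of D has weight 0
      under one of the two; x_i \<partial>_l would not, but it is affine because i < l.\<close>
    let ?E = "bracket (?T l) (bracket (?T i) D)"
    have W1: "bracket (?T i) D \<in> W_alg n"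
      using L bracket_T[OF il(1) D(1)] by (auto simp: lie_subalgebra_def)
    have "mono_field n (mvar l) i \<in> L"
    proof (rule mono_field_mem_of_diff[OF L])
      show "?E \<in> L"
        by (intro bracket_T il D)
      show "- Poly_Mapping.lookup (D (mvar i)) (Poly_Mapping.single l 1) \<noteq> 0"
        using nz by simp
      fix k m assume k: "k \<in> {1..n}" and m: "\<not> affine_monom k m"
      have E: "Poly_Mapping.lookup (?E (mvar k)) m =
          (of_nat (Poly_Mapping.lookup m l) - (if k = l then 1 else 0)) *
          ((of_nat (Poly_Mapping.lookup m i) - (if k = i then 1 else 0)) * Poly_Mapping.lookup (D (mvar k)) m)"
        by (simp only: lookup_bracket_torus[OF W1 il(2) k] lookup_bracket_torus[OF W il(1) k])
      consider "Poly_Mapping.lookup (D (mvar k)) m = 0"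
        | l' where "k < l'" "m = Poly_Mapping.single l' 1" | "m = Poly_Mapping.single k 2"
        using critm[OF _ k _ m] by blast
      then have "(of_nat (Poly_Mapping.lookup m l) - (if k = l then 1 else 0)) *
          ((of_nat (Poly_Mapping.lookup m i) - (if k = i then 1 else 0)) * Poly_Mapping.lookup (D (mvar k)) m) =
          (if k = i then Poly_Mapping.lookup (Poly_Mapping.single (Poly_Mapping.single l 1)
            (- Poly_Mapping.lookup (D (mvar i)) (Poly_Mapping.single l 1))) m else 0)" (is ?eq)
      proof cases
        case 1
        then show ?eq
          by (auto simp: lookup_single when_def)
      next
        case (2 l')
        have "Poly_Mapping.single l (1::nat) = Poly_Mapping.single l' 1 \<longleftrightarrow> l = l'"
          by (metis lookup_single_eq lookup_single_not_eq zero_neq_one)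
        then show ?eq
          using 2 il by (auto simp: lookup_single when_def)
      next
        case 3
        have "Poly_Mapping.single l (1::nat) \<noteq> Poly_Mapping.single k 2"
          by (metis lookup_single_eq lookup_single_not_eq one_eq_numeral_iff semiring_norm(83) zero_neq_one)
        then show ?eq
          using 3 il by (auto simp: lookup_single when_def)
      qed
      then show "Poly_Mapping.lookup (?E (mvar k)) m = (if k = i then
          Poly_Mapping.lookup (mconst (- Poly_Mapping.lookup (D (mvar i)) (Poly_Mapping.single l 1)) * mvar l) m else 0)"
        unfolding E mconst_mult_mvar .
    qed (use il in \<open>auto intro: mvar_in_polys\<close>)
    moreover have "mono_field n (mvar i) l \<in> L"
      using il L(2) by (intro subsetD[OF L(2)] mono_field_s_alg mvar_aff) auto
    ultimately show ?thesis
      using il by (intro not_solvable_linear[OF L(1), of i l]) auto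
  next
    case False
    have quad: "m = Poly_Mapping.single k 2"
      if "k \<in> {1..n}" "\<not> affine_monom k m" "Poly_Mapping.lookup (D (mvar k)) m \<noteq> 0" for k m
      using critm[OF _ that(1,3,2)] that False by blast
    obtain i m where i: "i \<in> {1..n}" "\<not> affine_monom i m" "Poly_Mapping.lookup (D (mvar i)) m \<noteq> 0"
      using D(2) s_algI_lookup[OF W] by blast
    define c where "c = Poly_Mapping.lookup (D (mvar i)) (Poly_Mapping.single i 2)"
    \<comment> \<open>Only squares are left now, and x_i \<partial>_i has weight 1 on x_i^2
      \<partial>_i and weight 0 on x_k^2 \<partial>_k for k \<noteq> i, so one bracket isolates the
      term.\<close>
    have "mono_field n (mvar i * mvar i) i \<in> L"
    proof (rule mono_field_mem_of_diff[OF L])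
      show "bracket (?T i) D \<in> L"
        by (intro bracket_T i D)
      show "c \<noteq> 0"
        using i quad[OF i] by (simp add: c_def)
      fix k m assume k: "k \<in> {1..n}" and m: "\<not> affine_monom k m"
      have "(of_nat (Poly_Mapping.lookup m i) - (if k = i then 1 else 0)) * Poly_Mapping.lookup (D (mvar k)) m =
            (if k = i then Poly_Mapping.lookup (Poly_Mapping.single (Poly_Mapping.single i 2) c) m else 0)" (is ?eq)
      proof (cases "Poly_Mapping.lookup (D (mvar k)) m = 0")
        case True
        then show ?eq
          by (auto simp: lookup_single when_def c_def)
      next
        case False
        then have "m = Poly_Mapping.single k 2"
          by (rule quad[OF k m])
        then show ?eq
          by (auto simp: lookup_single when_def c_def)
      qed
      then show "Poly_Mapping.lookup (bracket (?T i) D (mvar k)) m =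
          (if k = i then Poly_Mapping.lookup (mconst c * (mvar i * mvar i)) m else 0)"
        unfolding lookup_bracket_torus[OF W i(1) k] mconst_mult_mvar_square .
    qed (use i in \<open>auto intro!: mvar_in_polys polys_mult\<close>)
    moreover have "mono_field n 1 i \<in> L"
      using i L(2) by (intro subsetD[OF L(2)] mono_field_s_alg one_aff) auto
    ultimately show ?thesis
      using i by (intro not_solvable_quadratic[OF L(1), of i]) auto
  qed
qed

section \<open>Descent to such an element\<close>

text \<open>Induction on the bound \<open>d\<close>: if some [\<partial>_j, D] stays outside s_n, it
  lies in L and its degrees are bounded by one less. Since the bound is strict, \<open>d = 0\<close>
  leaves D without terms on the variables and hence in s_n, a contradiction.\<close>

lemma not_solvable_by_degree:
  fixes L :: "('a::field_char_0 mpoly \<Rightarrow> 'a mpoly) set"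
  assumes L: "lie_subalgebra n L" "s_alg n \<subseteq> L" and D: "D \<in> L" "D \<notin> s_alg n"
    and deg: "\<And>i m. i \<in> {1..n} \<Longrightarrow> m \<in> Poly_Mapping.keys (D (mvar i)) \<Longrightarrow>
      (\<Sum>k = 1..n. Poly_Mapping.lookup m k) < d"
  shows "\<not> lie_solvable L"
  using D deg
proof (induction d arbitrary: D)
  case 0
  have "D \<in> W_alg n"
    using L 0 by (auto simp: lie_subalgebra_def)
  then have "D \<in> s_alg n"
    using 0 by (intro s_algI_lookup) (auto simp: in_keys_iff)
  then show ?case using 0 by simp
next
  case (Suc d)
  have W: "D \<in> W_alg n"
    using L Suc by (auto simp: lie_subalgebra_def)
  show ?case
  proof (cases "\<forall>j \<in> {1..n}. bracket (mono_field n 1 j) D \<in> s_alg n")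
    case True
    then show ?thesis
      using Suc.prems by (intro critical_not_solvable[OF L, of D]) auto
  next
    case False
    then obtain j where j: "j \<in> {1..n}" and nin: "bracket (mono_field n 1 j) D \<notin> s_alg n"
      by blast
    have "1 \<in> (affine_polys j :: 'a mpoly set)"
      using j by (auto simp: affine_polys_iff affine_monom_def simp flip: single_one)
    then have "mono_field n 1 j \<in> L"
      using L(2) mono_field_s_alg[OF _ j] by blast
    then have mem: "bracket (mono_field n 1 j) D \<in> L"
      using L(1) Suc.prems by (simp add: lie_subalgebra_def)
    show ?thesis
    proof (rule Suc.IH[OF mem nin])
      fix i m assume i: "i \<in> {1..n}"
        and "m \<in> Poly_Mapping.keys (bracket (mono_field n 1 j) D (mvar i))"
      then have "Poly_Mapping.single j 1 + m \<in> Poly_Mapping.keys (D (mvar i))"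
        unfolding bracket_mono_field_1[OF W i j] in_keys_iff lookup_partial by auto
      then have "(\<Sum>k = 1..n. Poly_Mapping.lookup (Poly_Mapping.single j 1 + m) k) < Suc d"
        by (rule Suc.prems(3)[OF i])
      then show "(\<Sum>k = 1..n. Poly_Mapping.lookup m k) < d"
        using j by (simp add: lookup_add sum.distrib lookup_single when_def)
    qed
  qed
qed

lemma not_solvable_above_s_alg:
  fixes L :: "('a::field_char_0 mpoly \<Rightarrow> 'a mpoly) set"
  assumes L: "lie_subalgebra n L" "s_alg n \<subset> L"
  shows "\<not> lie_solvable L"
proof -
  obtain D where D: "D \<in> L" "D \<notin> s_alg n"
    using L by blast
  \<comment> \<open>The finitely many monomials of all components have a common strict degree bound,
    which starts the descent.\<close>
  define A where "A = (\<Union>i \<in> {1..n}. Poly_Mapping.keys (D (mvar i)))"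
  obtain d where "\<forall>x \<in> (\<lambda>m. \<Sum>k = 1..n. Poly_Mapping.lookup m k) ` A. x < d"
    using finite_nat_set_iff_bounded[of "(\<lambda>m. \<Sum>k = 1..n. Poly_Mapping.lookup m k) ` A"]
    by (auto simp: A_def)
  then show ?thesis
    using L by (intro not_solvable_by_degree[OF L(1) _ D, of d]) (auto simp: A_def)
qed

theorem theorem2:
  fixes n :: nat
  assumes "n \<ge> 1"
  shows "lie_subalgebra n (s_alg n :: ('a::{alg_closed_field, field_char_0} mpoly \<Rightarrow> 'a mpoly) set)
         \<and> lie_solvable (s_alg n :: ('a mpoly \<Rightarrow> 'a mpoly) set)
         \<and> \<not> (\<exists>S :: ('a mpoly \<Rightarrow> 'a mpoly) set. lie_subalgebra n S \<and> lie_solvable S \<and> s_alg n \<subset> S)"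
proof (intro conjI notI)
  show "lie_subalgebra n (s_alg n :: ('a mpoly \<Rightarrow> 'a mpoly) set)"
    by (rule lie_subalgebra_s_alg)
  show "lie_solvable (s_alg n :: ('a mpoly \<Rightarrow> 'a mpoly) set)"
    by (rule lie_solvable_s_alg)
  assume "\<exists>S :: ('a mpoly \<Rightarrow> 'a mpoly) set. lie_subalgebra n S \<and> lie_solvable S \<and> s_alg n \<subset> S"
  then show False
    by (elim exE conjE) (rule notE[OF not_solvable_above_s_alg])
qed

end
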